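(* Let $\mathcal L$ be a finite modular complemented lattice, and let $(\mathcal L,r)$ be an $\mathcal L$-polymatroid with set of cyclic flats $\mathcal Z$. For every $X\in\mathcal L$, $$r(X)=\min\{r(Z)+\mu_r(Z^c\wedge X): Z\in\mathcal Z,\ Z^c\in\mathbf C(Z;X)\}.$$ Moreover, if $Z=\mathrm{cyc}(\mathrm{cl}(X))$, then $r(X)=r(Z)+\mu_r(X\wedge Z^c)$ for every $Z^c\in\mathbf C(Z;X)$.
   Context: $\mathcal L$ has order $\le$, meet $\wedge$, join $\vee$, least element $\mathbf 0$ and greatest element $\mathbf 1$. $\mathrm h(A)$ is the height of $A$. $\mathcal A(X)$ is the set of atoms below $X$, and $\mathcal H(X)$ is the set of elements covered by $X$. Complements: $\mathbf C(A)=\{C: C\wedge A=\mathbf 0, C\vee A=\mathbf 1\}$ and $\mathbf C(A;B)=\{A^c\in\mathbf C(A):(A^c\wedge B)\vee(A\wedge B)=B\}$. An $\mathcal L$-polymatroid is a pair $(\mathcal L,r)$ with $r:\mathcal L\to\mathbb R$ such that, for some $t\ge0$ and all $A,B$: - $0\le r(A)\le t\,\mathrm h(A)$; - $r$ is increasing; - $r(A)-r(A\wedge B)\ge r(A\vee B)-r(B)$. Notions for $(\mathcal L,r)$: - $X$ is a flat if $r(X)<r(X\vee x)$ for all $x\not\le X$. - $X$ is cyclic if for every $H\in\mathcal H(X)$, either $r(X)=r(H)$, or $0<r(X)-r(H)$ and there is $a\in\mathcal A(X)\setminus\mathcal A(H)$ with $r(X)-r(H)<r(a)$. - A cyclic flat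 is an element that is both cyclic and a flat. - $\mathrm{cyc}(X)$ is the join of all cyclic $Y\le X$. - $\mathrm{cl}(X)$ is the join of all $x$ with $r(X\vee x)=r(X)$. $\mu_r(\mathbf 0)=0$, and for $A\ne\mathbf 0$, $\mu_r(A)=\min\{\sum_{x\in\beta}r(x): \beta\subseteq\mathcal A(A),\ |\beta|=\mathrm h(A),\ \bigvee\beta=A\}$. *)

theory Defs
  imports Complex_Main
begin

class modular_lattice = lattice +
  assumes modular_law: "a \<le> b \<Longrightarrow> sup a (inf c b) = inf (sup a c) b"

(* Unlike complemented_lattice in HOL-Library, this does not fix a complementation operation. *)
class complementable_lattice = bounded_lattice +
  assumes complement_exists: "\<exists>c. inf c a = bot \<and> sup c a = top"

definition covered_by :: "'a::order \<Rightarrow> 'a \<Rightarrow> bool" where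
  "covered_by a b \<longleftrightarrow> a < b \<and> \<not> (\<exists>c. a < c \<and> c < b)"

definition atoms_below :: "'a::order_bot \<Rightarrow> 'a set" where
  "atoms_below X = {a. covered_by bot a \<and> a \<le> X}"

definition hyperplanes :: "'a::order \<Rightarrow> 'a set" where
  "hyperplanes X = {H. covered_by H X}"

(* Maximal length of a chain from bot to A; a chain with n + 1 elements has length n. *)
definition height :: "'a::{finite,order_bot} \<Rightarrow> nat" where
  "height A = Max {card C - 1 | C.
     Complete_Partial_Order.chain (\<le>) C \<and> bot \<in> C \<and> A \<in> C \<and> C \<subseteq> {..A}}"

definition complements :: "'a::bounded_lattice \<Rightarrow> 'a set" where
  "complements A = {C. inf C A = bot \<and> sup C A = top}"

definition complements_wrt :: "'a::bounded_lattice \<Rightarrow> 'a \<Rightarrow> 'a set" where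
  "complements_wrt A B = {Ac \<in> complements A. sup (inf Ac B) (inf A B) = B}"

(* A finite lattice is complete, so complete_lattice only makes Sup available for joins of sets. *)
definition polymatroid :: "('a::{finite,complete_lattice} \<Rightarrow> real) \<Rightarrow> bool" where
  "polymatroid r \<longleftrightarrow>
     (\<exists>t\<ge>0. \<forall>A. 0 \<le> r A \<and> r A \<le> t * real (height A)) \<and>
     mono r \<and>
     (\<forall>A B. r A - r (inf A B) \<ge> r (sup A B) - r B)"

definition flat :: "('a::{finite,complete_lattice} \<Rightarrow> real) \<Rightarrow> 'a \<Rightarrow> bool" where
  "flat r X \<longleftrightarrow> (\<forall>x. \<not> x \<le> X \<longrightarrow> r X < r (sup X x))"

definition cyclic :: "('a::{finite,complete_lattice} \<Rightarrow> real) \<Rightarrow> 'a \<Rightarrow> bool" where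
  "cyclic r X \<longleftrightarrow> (\<forall>H\<in>hyperplanes X.
     r X = r H \<or>
     (0 < r X - r H \<and> (\<exists>a\<in>atoms_below X - atoms_below H. r X - r H < r a)))"

definition cyclic_flats :: "('a::{finite,complete_lattice} \<Rightarrow> real) \<Rightarrow> 'a set" where
  "cyclic_flats r = {Z. cyclic r Z \<and> flat r Z}"

definition cyc :: "('a::{finite,complete_lattice} \<Rightarrow> real) \<Rightarrow> 'a \<Rightarrow> 'a" where
  "cyc r X = Sup {Y. cyclic r Y \<and> Y \<le> X}"

definition cl :: "('a::{finite,complete_lattice} \<Rightarrow> real) \<Rightarrow> 'a \<Rightarrow> 'a" where
  "cl r X = Sup {x. r (sup X x) = r X}"

definition mu :: "('a::{finite,complete_lattice} \<Rightarrow> real) \<Rightarrow> 'a \<Rightarrow> real" where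
  "mu r A = (if A = bot then 0
     else Min {(\<Sum>x\<in>\<beta>. r x) | \<beta>. \<beta> \<subseteq> atoms_below A \<and> card \<beta> = height A \<and> Sup \<beta> = A})"

end

theory Submission
  imports Defs
begin

text \<open>
  By submodularity, \<open>r X - r H \<le> r a\<close> for every hyperplane \<open>H\<close> of \<open>X\<close> and every atom \<open>a\<close> below \<open>X\<close>
  but not below \<open>H\<close>. So if \<open>F\<close> is not cyclic, it has a hyperplane \<open>H\<close> for which all these atoms have
  the same rank \<open>r F - r H > 0\<close>, and such an \<open>H\<close> contains every cyclic element below \<open>F\<close>. Iterating
  gives a maximal chain from \<open>F = cl X\<close> down to \<open>Z = cyc F\<close>. Intersecting the chain with
  \<open>A = X \<sqinter> Z\<^sup>c\<close> and choosing one atom of \<open>A\<close> per step yields a basis of \<open>A\<close> of total rank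
  \<open>r X - r Z\<close>, so \<open>\<mu> A \<le> r X - r Z\<close>. The opposite inequality is subadditivity of \<open>r\<close>, and holds for
  every element in place of \<open>Z\<close>.
\<close>

section \<open>Covers, atoms and height in modular lattices\<close>

lemma covered_by_less: "covered_by a b \<Longrightarrow> a < b"
  by (simp add: covered_by_def)

lemma covered_by_eq:
  assumes "covered_by a b" "a \<le> c" "c \<le> b" "c \<noteq> a"
  shows "c = b"
  using assms unfolding covered_by_def by (metis order.not_eq_order_implies_strict)

lemma covered_by_sup:
  fixes H A Y :: "'a::lattice"
  assumes "covered_by H A" "Y \<le> A" "\<not> Y \<le> H"
  shows "sup H Y = A"
  using assms covered_by_eq[OF assms(1), of "sup H Y"] covered_by_less[OF assms(1)]
  by (metis le_supI order_less_imp_le sup.cobounded1 sup.cobounded2)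

text \<open>By the modular law, an element \<open>c\<close> strictly between \<open>inf H Y\<close>
  and \<open>Y\<close> satisfies \<open>c = inf (sup c H) Y\<close>; since
  \<open>sup H c = A\<close>, this forces \<open>c = Y\<close>.\<close>

lemma covered_by_inf:
  fixes H A Y :: "'a::modular_lattice"
  assumes cov: "covered_by H A" and "Y \<le> A" "\<not> Y \<le> H"
  shows "covered_by (inf H Y) Y"
  unfolding covered_by_def
proof (intro conjI notI)
  show "inf H Y < Y"
    using assms by (metis inf.absorb_iff2 inf.cobounded2 order.not_eq_order_implies_strict)
  assume "\<exists>c. inf H Y < c \<and> c < Y"
  then obtain c where c: "inf H Y < c" "c < Y" by blast
  have "\<not> c \<le> H"
    using c by (metis inf.boundedI leD order_less_imp_le)
  then have "sup H c = A"
    using covered_by_sup[OF cov] c assms(2) by (meson order.trans order_less_imp_le)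
  moreover have "sup c (inf H Y) = inf (sup c H) Y"
    using c by (intro modular_law) simp
  moreover have "sup c (inf H Y) = c"
    using c by (simp add: sup.absorb1)
  ultimately show False
    using c assms(2) by (simp add: sup.commute inf.absorb2)
qed

lemma ex_hyperplane_above:
  fixes B A :: "'a::{finite,order}"
  assumes "B < A"
  obtains H where "covered_by H A" "B \<le> H"
proof -
  obtain H where "H \<in> {B..<A}" "\<And>c. c \<in> {B..<A} \<Longrightarrow> H \<le> c \<Longrightarrow> c = H"
    using finite_has_maximal[of "{B..<A}"] assms
    by (metis atLeastLessThan_iff empty_iff finite order.refl)
  then show thesis
    using that[of H] unfolding covered_by_def
    by (metis atLeastLessThan_iff order.strict_implies_not_eq order.strict_trans1 order_less_imp_le)
qed

lemma ex_atom_below: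
  fixes A :: "'a::{finite,order_bot}"
  assumes "A \<noteq> bot"
  obtains a where "a \<in> atoms_below A"
proof -
  obtain a where a: "a \<in> {bot<..A}" "\<And>c. c \<in> {bot<..A} \<Longrightarrow> c \<le> a \<Longrightarrow> c = a"
    using finite_has_minimal[of "{bot<..A}"] assms
    by (metis bot.not_eq_extremum empty_iff finite greaterThanAtMost_iff order.refl)
  have "covered_by bot a"
    unfolding covered_by_def
    using a by (metis greaterThanAtMost_iff order.strict_implies_not_eq order.trans order_less_imp_le)
  then show thesis
    using that[of a] a by (simp add: atoms_below_def)
qed

text \<open>A complement of \<open>B\<close> in the whole lattice, cut down to \<open>A\<close>,
  still joins with \<open>B\<close> to \<open>A\<close> by modularity.\<close>

lemma ex_relative_complement:
  fixes B A :: "'a::{modular_lattice,complementable_lattice}"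
  assumes "B \<le> A"
  obtains D where "D \<le> A" "inf D B = bot" "sup D B = A"
proof -
  obtain c where c: "inf c B = bot" "sup c B = top"
    using complement_exists by blast
  have "sup B (inf c A) = inf (sup B c) A"
    using assms by (rule modular_law)
  then have "sup (inf c A) B = A"
    using c by (simp add: sup.commute)
  moreover have "inf (inf c A) B = bot"
    using c assms by (metis inf.absorb2 inf.assoc)
  ultimately show thesis
    using that[of "inf c A"] by simp
qed

lemma ex_atom_below_not_below:
  fixes x H :: "'a::{finite,modular_lattice,complementable_lattice}"
  assumes "\<not> x \<le> H"
  obtains a where "a \<in> atoms_below x" "\<not> a \<le> H"
proof -
  \<comment> \<open>An atom of \<open>D\<close> below \<open>H\<close> would lie in
    \<open>inf D (inf x H)\<close>, which is \<open>bot\<close>.\<close>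
  obtain D where D: "D \<le> x" "inf D (inf x H) = bot" "sup D (inf x H) = x"
    using ex_relative_complement[of "inf x H" x] by auto
  have "D \<noteq> bot"
    using D(3) assms by (metis inf.cobounded2 sup_bot_left)
  then obtain a where a: "a \<in> atoms_below D"
    by (rule ex_atom_below)
  then have ax: "a \<le> D" "a \<le> x" "a \<noteq> bot"
    using D(1) by (auto simp: atoms_below_def covered_by_def)
  then have "\<not> a \<le> H"
    using D(2) by (metis bot.extremum_uniqueI inf.boundedI)
  then show thesis
    using that a ax by (simp add: atoms_below_def)
qed

text \<open>A complement \<open>D\<close> of \<open>inf Z X\<close> inside \<open>X\<close> provides
  the splitting of \<open>X\<close>; joining it with a complement \<open>E\<close> of
  \<open>sup D Z\<close> turns it into a complement of \<open>Z\<close>.\<close>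

lemma ex_complements_wrt:
  fixes Z X :: "'a::{modular_lattice,complementable_lattice}"
  shows "complements_wrt Z X \<noteq> {}"
proof -
  obtain D where D: "D \<le> X" "inf D (inf Z X) = bot" "sup D (inf Z X) = X"
    using ex_relative_complement[of "inf Z X" X] by auto
  obtain E where E: "inf E (sup D Z) = bot" "sup E (sup D Z) = top"
    using complement_exists by blast
  \<comment> \<open>By modularity \<open>E\<close> contributes nothing below \<open>sup D Z\<close>,
    so \<open>sup D E\<close> meets \<open>Z\<close> exactly as \<open>D\<close> does.\<close>
  have "sup D (inf E (sup D Z)) = inf (sup D E) (sup D Z)"
    by (rule modular_law) simp
  then have "inf (sup D E) (sup D Z) = D"
    using E by simp
  then have "inf (sup D E) Z = inf D Z"
    by (metis inf.absorb2 inf.assoc sup.cobounded2)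
  moreover have "inf D Z = bot"
    using D by (metis inf.absorb1 inf.assoc inf.commute)
  moreover have "sup (sup D E) Z = top"
    using E by (metis sup.assoc sup.commute)
  moreover have "sup (inf (sup D E) X) (inf Z X) = X"
  proof (rule order.antisym)
    have "sup D (inf Z X) \<le> sup (inf (sup D E) X) (inf Z X)"
      using D(1) by (intro sup_mono) auto
    then show "X \<le> sup (inf (sup D E) X) (inf Z X)"
      using D by simp
  qed simp
  ultimately have "sup D E \<in> complements_wrt Z X"
    by (simp add: complements_wrt_def complements_def)
  then show ?thesis by blast
qed

section \<open>Height and its growth along covers\<close>

lemma card_chain_le_height:
  fixes A :: "'a::{finite,order_bot}"
  assumes "Complete_Partial_Order.chain (\<le>) C" "bot \<in> C" "A \<in> C" "C \<subseteq> {..A}"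
  shows "card C \<le> height A + 1"
proof -
  have "card C - 1 \<le> height A"
    unfolding height_def
    by (rule Max_ge) (use assms in \<open>auto intro: finite_image_set\<close>)
  then show ?thesis by simp
qed

lemma height_attained:
  fixes A :: "'a::{finite,order_bot}"
  obtains C where "Complete_Partial_Order.chain (\<le>) C" "bot \<in> C" "A \<in> C" "C \<subseteq> {..A}"
    "card C = height A + 1"
proof -
  let ?S = "{card C - 1 | C. Complete_Partial_Order.chain (\<le>) C \<and> bot \<in> C \<and> A \<in> C \<and> C \<subseteq> {..A}}"
  have "Complete_Partial_Order.chain (\<le>) {bot, A}"
    by (auto simp: chain_def)
  then have "?S \<noteq> {}" by auto
  moreover have "finite ?S"
    by (auto intro: finite_image_set)
  ultimately have "height A \<in> ?S"
    unfolding height_def by (rule Max_in[rotated])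
  then obtain C where C: "Complete_Partial_Order.chain (\<le>) C" "bot \<in> C" "A \<in> C" "C \<subseteq> {..A}"
    "height A = card C - 1"
    by blast
  moreover have "card C > 0"
    using C(2) by (auto simp: card_gt_0_iff)
  ultimately show thesis
    using that[of C] by simp
qed

lemma height_bot [simp]: "height (bot :: 'a::{finite,order_bot}) = 0"
proof -
  obtain C where "C \<subseteq> {..bot::'a}" "card C = height (bot::'a) + 1"
    by (rule height_attained)
  moreover from this(1) have "card C \<le> card {bot::'a}"
    by (intro card_mono) (auto simp: bot_unique)
  ultimately show ?thesis by simp
qed

lemma height_less:
  fixes B A :: "'a::{finite,order_bot}"
  assumes "B < A"
  shows "height B < height A"
proof -
  obtain C where C: "Complete_Partial_Order.chain (\<le>) C" "bot \<in> C" "B \<in> C" "C \<subseteq> {..B}"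
    "card C = height B + 1"
    by (rule height_attained)
  have "A \<notin> C" using C(4) assms by auto
  have "Complete_Partial_Order.chain (\<le>) (insert A C)"
    using C(1,4) assms unfolding chain_def by (auto simp: subset_iff)
  then have "card (insert A C) \<le> height A + 1"
    by (rule card_chain_le_height) (use C assms in auto)
  with \<open>A \<notin> C\<close> C(5) show ?thesis by simp
qed

text \<open>In a longest chain, replacing the top \<open>A\<close> by a hyperplane above the next
  largest member \<open>m\<close> loses at most one element.\<close>

lemma height_le_Suc_hyperplane:
  fixes A :: "'a::{finite,order_bot}"
  assumes "A \<noteq> bot"
  obtains H where "covered_by H A" "height A \<le> height H + 1"
proof -
  obtain C where C: "Complete_Partial_Order.chain (\<le>) C" "bot \<in> C" "A \<in> C" "C \<subseteq> {..A}"
    "card C = height A + 1"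
    by (rule height_attained)
  obtain m where m: "m \<in> C - {A}" "\<And>c. c \<in> C - {A} \<Longrightarrow> m \<le> c \<Longrightarrow> c = m"
    using finite_has_maximal[of "C - {A}"] assms C(2) by auto
  have le: "c \<le> m" if "c \<in> C - {A}" for c
    using C(1) m that unfolding chain_def by (metis DiffD1 order.refl)
  have "m < A" using m C(4) by auto
  then obtain H where H: "covered_by H A" "m \<le> H"
    by (rule ex_hyperplane_above)
  let ?D = "insert H (C - {A})"
  have *: "c \<le> H" if "c \<in> C - {A}" for c
    using le[OF that] H(2) by simp
  have "Complete_Partial_Order.chain (\<le>) ?D"
    using C(1) * unfolding chain_def by auto
  then have "card ?D \<le> height H + 1"
    by (rule card_chain_le_height) (use C(2) assms * in auto)
  moreover have "card (C - {A}) \<le> card ?D"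
    by (rule card_mono) auto
  ultimately have "height A \<le> height H + 1"
    using C(3,5) by simp
  then show thesis using that H by blast
qed

text \<open>Compare \<open>H\<close> with a hyperplane \<open>K\<close> obtained from a longest
  chain. If they differ, \<open>inf H K\<close> is covered by both, and induction at
  \<open>K\<close> gives \<open>height K \<le> height H\<close>.\<close>

lemma height_covered_by:
  fixes A H :: "'a::{finite,order_bot,modular_lattice}"
  assumes "covered_by H A"
  shows "height A = height H + 1"
proof -
  have "height A \<le> height H + 1"
    using assms
  proof (induction "height A" arbitrary: A H rule: less_induct)
    case less
    have "A \<noteq> bot"
      using covered_by_less[OF less.prems] by auto
    then obtain K where K: "covered_by K A" "height A \<le> height K + 1"
      by (rule height_le_Suc_hyperplane)
    show ?case
    proof (cases "K = H")
      case False
      have "\<not> K \<le> H" "\<not> H \<le> K"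
        using False K(1) less.prems unfolding covered_by_def by (metis order.not_eq_order_implies_strict)+
      then have "covered_by (inf H K) K" "covered_by (inf K H) H"
        using covered_by_inf K(1) less.prems covered_by_less by (metis order_less_imp_le)+
      then have "height K \<le> height (inf H K) + 1" "height (inf K H) < height H"
        using less.hyps[of K "inf H K"] height_less[OF covered_by_less[OF K(1)]]
        by (simp_all add: height_less covered_by_less)
      then show ?thesis using K(2) by (simp add: inf.commute)
    qed (use K in simp)
  qed
  moreover have "height H < height A"
    using assms by (intro height_less covered_by_less)
  ultimately show ?thesis by simp
qed

section \<open>Atom bases\<close>

text \<open>The sets over which \<open>mu\<close> minimises. At \<open>bot\<close> only the empty
  set qualifies, so one \<open>Min\<close> formula also yields the value \<open>0\<close> that
  \<open>mu\<close> has there.\<close>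

definition atom_basis :: "'a::{finite,complete_lattice} \<Rightarrow> 'a set \<Rightarrow> bool" where
  "atom_basis A \<beta> \<longleftrightarrow> \<beta> \<subseteq> atoms_below A \<and> card \<beta> = height A \<and> Sup \<beta> = A"

lemma atom_basis_bot: "atom_basis (bot::'a::{finite,complete_lattice}) \<beta> \<longleftrightarrow> \<beta> = {}"
  by (auto simp: atom_basis_def)

text \<open>The new atom lifts the join from \<open>H\<close> to \<open>A\<close>, and height and
  cardinality both grow by exactly one.\<close>

lemma atom_basis_insert:
  fixes A H :: "'a::{finite,complete_lattice,modular_lattice}"
  assumes "covered_by H A" "atom_basis H \<beta>" "a \<in> atoms_below A" "\<not> a \<le> H"
  shows "atom_basis A (insert a \<beta>)" "a \<notin> \<beta>"
proof -
  have le: "H \<le> A" using covered_by_less[OF assms(1)] by simp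
  show "a \<notin> \<beta>"
    using assms(2,4) by (auto simp: atom_basis_def atoms_below_def)
  moreover have "sup H a = A"
    using assms by (intro covered_by_sup) (auto simp: atoms_below_def)
  ultimately show "atom_basis A (insert a \<beta>)"
    using assms order.trans[OF _ le] height_covered_by[OF assms(1)]
    by (simp add: atom_basis_def atoms_below_def sup.commute subset_iff)
qed

text \<open>Ensures that the minimum defining \<open>mu\<close> ranges over a nonempty set.\<close>

lemma ex_atom_basis:
  fixes A :: "'a::{finite,complete_lattice,modular_lattice,complementable_lattice}"
  shows "\<exists>\<beta>. atom_basis A \<beta>"
proof (induction "height A" arbitrary: A rule: less_induct)
  case less
  show ?case
  proof (cases "A = bot")
    case False
    then obtain H where H: "covered_by H A"
      by (rule height_le_Suc_hyperplane)
    then have "H < A" by (rule covered_by_less)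
    then obtain \<beta> where "atom_basis H \<beta>"
      using less height_less by blast
    moreover obtain a where "a \<in> atoms_below A" "\<not> a \<le> H"
      using ex_atom_below_not_below[of A H] \<open>H < A\<close> by (auto simp: less_le_not_le)
    ultimately show ?thesis
      using atom_basis_insert(1)[OF H] by blast
  qed (auto simp: atom_basis_bot)
qed

lemma mu_eq_Min:
  "mu r A = Min {(\<Sum>x\<in>\<beta>. r x) | \<beta>. atom_basis A \<beta>}"
  by (cases "A = bot") (auto simp: mu_def atom_basis_bot, simp add: atom_basis_def)

lemma mu_le: "atom_basis A \<beta> \<Longrightarrow> mu r A \<le> (\<Sum>x\<in>\<beta>. r x)"
  unfolding mu_eq_Min by (rule Min_le) (auto intro: finite_image_set)

lemma mu_attained:
  fixes A :: "'a::{finite,complete_lattice,modular_lattice,complementable_lattice}"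
  obtains \<beta> where "atom_basis A \<beta>" "mu r A = (\<Sum>x\<in>\<beta>. r x)"
proof -
  have "mu r A \<in> {(\<Sum>x\<in>\<beta>. r x) | \<beta>. atom_basis A \<beta>}"
    unfolding mu_eq_Min using ex_atom_basis[of A]
    by (intro Min_in) (auto intro: finite_image_set)
  then show thesis using that by blast
qed

section \<open>Polymatroids\<close>

locale lattice_polymatroid =
  fixes r :: "'a::{finite,complete_lattice} \<Rightarrow> real"
  assumes polymatroid: "polymatroid r"
begin

lemma nonneg: "0 \<le> r A"
  using polymatroid by (auto simp: polymatroid_def)

lemma rank_mono: "A \<le> B \<Longrightarrow> r A \<le> r B"
  using polymatroid by (auto simp: polymatroid_def mono_def)

lemma submodular: "r (sup A B) + r (inf A B) \<le> r A + r B"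
  using polymatroid unfolding polymatroid_def by (smt (verit))

lemma rank_bot: "r bot = 0"
proof -
  obtain t where "r bot \<le> t * real (height (bot::'a))"
    using polymatroid unfolding polymatroid_def by blast
  then show ?thesis using nonneg[of bot] by simp
qed

lemma rank_sup_le: "r (sup A B) \<le> r A + r B"
  using submodular[of A B] nonneg[of "inf A B"] by linarith

lemma rank_Sup_le: "r (Sup \<beta>) \<le> (\<Sum>x\<in>\<beta>. r x)"
proof (induction \<beta> rule: finite_induct[OF finite])
  case (2 x \<beta>)
  then show ?case using rank_sup_le[of x "Sup \<beta>"] by simp
qed (simp add: rank_bot)

text \<open>Submodularity as diminishing increments; monotonicity lets any common lower bound
  \<open>B\<close> replace the meet.\<close>

lemma submodular_diff:
  assumes "B \<le> inf A C"
  shows "r (sup A C) - r C \<le> r A - r B"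
  using submodular[of A C] rank_mono[OF assms] by linarith

lemma rank_diff_le_atom:
  assumes "covered_by H A" "a \<in> atoms_below A" "\<not> a \<le> H"
  shows "r A - r H \<le> r a"
  using rank_sup_le[of H a] covered_by_sup[OF assms(1), of a] assms(2,3)
  by (simp add: atoms_below_def)

text \<open>Elements are joined one at a time: each adds no more rank to
  \<open>sup X (Sup S)\<close> than to \<open>X\<close>, that is, none.\<close>

lemma rank_sup_cl: "r (sup X (cl r X)) = r X"
proof -
  have "r (sup X (Sup S)) = r X" if "S \<subseteq> {x. r (sup X x) = r X}" for S
    using finite[of S] that
  proof (induction S rule: finite_induct)
    case (insert x S)
    have "r (sup (sup X x) (sup X (Sup S))) - r (sup X (Sup S)) \<le> r (sup X x) - r X"
      by (rule submodular_diff) simp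
    then have "r (sup X (Sup (insert x S))) \<le> r X"
      using insert by (simp add: ac_simps)
    moreover have "r X \<le> r (sup X (Sup (insert x S)))"
      by (rule rank_mono) simp
    ultimately show ?case by simp
  qed simp
  then show ?thesis by (simp add: cl_def)
qed

lemma le_cl_iff: "x \<le> cl r X \<longleftrightarrow> r (sup X x) = r X"
proof
  assume "x \<le> cl r X"
  then have "r (sup X x) \<le> r (sup X (cl r X))"
    by (intro rank_mono sup_mono) auto
  then show "r (sup X x) = r X"
    using rank_sup_cl[of X] rank_mono[of X "sup X x"] by simp
qed (auto simp: cl_def intro: Sup_upper)

lemma le_cl: "X \<le> cl r X"
  by (simp add: le_cl_iff)

lemma rank_cl: "r (cl r X) = r X"
  using rank_sup_cl[of X] le_cl[of X] by (simp add: sup.absorb2)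

lemma flat_cl: "flat r (cl r X)"
  unfolding flat_def
proof (intro allI impI)
  fix x assume "\<not> x \<le> cl r X"
  then have "r (sup X x) \<noteq> r X"
    by (simp add: le_cl_iff)
  then have "r X < r (sup X x)"
    using rank_mono[of X "sup X x"] by simp
  also have "\<dots> \<le> r (sup (cl r X) x)"
    using le_cl[of X] by (intro rank_mono sup_mono) auto
  finally show "r (cl r X) < r (sup (cl r X) x)"
    by (simp add: rank_cl)
qed

text \<open>The strict positivity required in the definition of \<open>cyclic\<close> follows from monotonicity.\<close>

lemma cyclic_iff:
  "cyclic r X \<longleftrightarrow> (\<forall>H. covered_by H X \<longrightarrow>
     r X = r H \<or> (\<exists>a\<in>atoms_below X. \<not> a \<le> H \<and> r X - r H < r a))"
proof -
  have "r X = r H \<or> 0 < r X - r H" if "covered_by H X" for H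
    using rank_mono[of H X] covered_by_less[OF that] by fastforce
  moreover have "a \<in> atoms_below X - atoms_below H \<longleftrightarrow> a \<in> atoms_below X \<and> \<not> a \<le> H" for a H
    by (auto simp: atoms_below_def)
  ultimately show ?thesis
    unfolding cyclic_def hyperplanes_def by blast
qed

end

section \<open>Cyclic elements in a modular lattice\<close>

locale modular_polymatroid = lattice_polymatroid r
  for r :: "'a::{finite,complete_lattice,modular_lattice} \<Rightarrow> real"
begin

text \<open>\<open>inf H Y\<close> is a hyperplane of \<open>Y\<close>, and the increment from
  \<open>H\<close> to \<open>X\<close> is at most that from \<open>inf H Y\<close> to
  \<open>Y\<close>. Hence an atom witnessing cyclicity of \<open>Y\<close> also serves
  \<open>H\<close>.\<close>

lemma cyclic_below_not_below_hyperplane: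
  assumes cyc: "cyclic r Y" and H: "covered_by H X" and "Y \<le> X" "\<not> Y \<le> H"
  shows "r X = r H \<or> (\<exists>a\<in>atoms_below X. \<not> a \<le> H \<and> r X - r H < r a)"
proof -
  have cov: "covered_by (inf H Y) Y"
    using assms by (intro covered_by_inf)
  have "sup Y H = X"
    using covered_by_sup[OF H assms(3,4)] by (simp add: sup.commute)
  then have le: "r X - r H \<le> r Y - r (inf H Y)"
    using submodular_diff[of "inf H Y" Y H] by simp
  have ge: "r H \<le> r X"
    using H by (intro rank_mono order_less_imp_le covered_by_less)
  have "r Y = r (inf H Y) \<or> (\<exists>a\<in>atoms_below Y. \<not> a \<le> inf H Y \<and> r Y - r (inf H Y) < r a)"
    using cyc cov unfolding cyclic_iff by blast
  then show ?thesis
  proof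
    assume "\<exists>a\<in>atoms_below Y. \<not> a \<le> inf H Y \<and> r Y - r (inf H Y) < r a"
    then obtain a where "a \<in> atoms_below Y" "\<not> a \<le> inf H Y" "r Y - r (inf H Y) < r a"
      by blast
    then show ?thesis
      using le assms(3) by (intro disjI2 bexI[of _ a]) (auto simp: atoms_below_def)
  qed (use le ge in simp)
qed

text \<open>A hyperplane of the join fails to contain some cyclic \<open>Y \<le> X\<close>, whose
  cyclicity transfers by the preceding lemma.\<close>

lemma cyclic_cyc: "cyclic r (cyc r X)"
  unfolding cyclic_iff
proof (intro allI impI)
  fix H assume H: "covered_by H (cyc r X)"
  then have "\<not> cyc r X \<le> H"
    using covered_by_less by (auto simp: less_le_not_le)
  then obtain Y where "cyclic r Y" "Y \<le> X" "\<not> Y \<le> H"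
    unfolding cyc_def by (auto simp: Sup_le_iff)
  moreover from this have "Y \<le> cyc r X"
    by (auto simp: cyc_def intro: Sup_upper)
  ultimately show "r (cyc r X) = r H \<or>
      (\<exists>a\<in>atoms_below (cyc r X). \<not> a \<le> H \<and> r (cyc r X) - r H < r a)"
    using H by (intro cyclic_below_not_below_hyperplane)
qed

lemma cyc_le: "cyc r X \<le> X"
  by (auto simp: cyc_def intro: Sup_least)

lemma cyc_greatest: "cyclic r Y \<Longrightarrow> Y \<le> X \<Longrightarrow> Y \<le> cyc r X"
  by (auto simp: cyc_def intro: Sup_upper)

text \<open>An \<open>x\<close> adding no rank to \<open>cyc r F\<close> lies in \<open>F\<close> by
  flatness and makes \<open>sup (cyc r F) x\<close> a cyclic element below \<open>F\<close>, hence
  below \<open>cyc r F\<close>.\<close>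

lemma flat_cyc:
  assumes F: "flat r F"
  shows "flat r (cyc r F)"
  unfolding flat_def
proof (intro allI impI, rule ccontr)
  let ?Z = "cyc r F"
  fix x assume x: "\<not> x \<le> ?Z" and "\<not> r ?Z < r (sup ?Z x)"
  let ?W = "sup ?Z x"
  have eq: "r ?W = r ?Z"
    using \<open>\<not> r ?Z < r ?W\<close> rank_mono[of ?Z ?W] by simp
  \<comment> \<open>Diminishing increments carry the zero increment from \<open>?Z\<close> up to
    \<open>F\<close>.\<close>
  have "r (sup ?W F) - r F \<le> r ?W - r ?Z"
    using cyc_le by (intro submodular_diff) simp
  moreover have "r (sup F x) \<le> r (sup ?W F)"
    by (intro rank_mono) (simp add: le_supI1)
  ultimately have "r (sup F x) \<le> r F"
    using eq by linarith
  then have "x \<le> F"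
    using F unfolding flat_def by fastforce
  have "cyclic r ?W"
    unfolding cyclic_iff
  proof (intro allI impI)
    fix H assume H: "covered_by H ?W"
    show "r ?W = r H \<or> (\<exists>b\<in>atoms_below ?W. \<not> b \<le> H \<and> r ?W - r H < r b)"
    \<comment> \<open>A hyperplane containing \<open>?Z\<close> has its rank squeezed between the
      equal ranks of \<open>?Z\<close> and \<open>?W\<close>; any other is handled by cyclicity of
      \<open>?Z\<close>.\<close>
    proof (cases "?Z \<le> H")
      case True
      then have "r ?Z \<le> r H" "r H \<le> r ?W"
        using covered_by_less[OF H] by (simp_all add: rank_mono)
      then show ?thesis using eq by simp
    next
      case False
      then show ?thesis
        using H by (intro cyclic_below_not_below_hyperplane[OF cyclic_cyc]) auto
    qed
  qed
  then have "?W \<le> ?Z"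
    using \<open>x \<le> F\<close> cyc_le by (intro cyc_greatest) auto
  with x show False by simp
qed

lemma cyc_cl_in_cyclic_flats: "cyc r (cl r X) \<in> cyclic_flats r"
  by (simp add: cyclic_flats_def cyclic_cyc flat_cyc flat_cl)

text \<open>The descent step. Since \<open>cyc\<close> does not change, it can be iterated towards
  one fixed cyclic element.\<close>

lemma noncyclic_hyperplane:
  assumes "\<not> cyclic r F"
  obtains H where "covered_by H F" "r H < r F" "cyc r H = cyc r F"
    "\<And>a. a \<in> atoms_below F \<Longrightarrow> \<not> a \<le> H \<Longrightarrow> r a = r F - r H"
proof -
  obtain H where H: "covered_by H F" "r F \<noteq> r H"
    and at: "\<not> (\<exists>a\<in>atoms_below F. \<not> a \<le> H \<and> r F - r H < r a)"
    using assms by (auto simp: cyclic_iff)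
  have "H < F" using H by (intro covered_by_less)
  \<comment> \<open>Otherwise cyclicity of \<open>cyc r F\<close> would transfer to
    \<open>H\<close>, contrary to the choice of \<open>H\<close>.\<close>
  have "cyc r F \<le> H"
    using cyclic_below_not_below_hyperplane[OF cyclic_cyc H(1) cyc_le] H(2) at by blast
  then have "cyc r F \<le> cyc r H"
    by (intro cyc_greatest cyclic_cyc)
  moreover have "cyc r H \<le> cyc r F"
    using cyc_le[of H] \<open>H < F\<close> by (intro cyc_greatest cyclic_cyc) auto
  moreover have "r a = r F - r H" if "a \<in> atoms_below F" "\<not> a \<le> H" for a
    using rank_diff_le_atom[OF H(1) that] at that by fastforce
  moreover have "r H < r F"
    using rank_mono[OF order_less_imp_le[OF \<open>H < F\<close>]] H(2) by simp
  ultimately show thesis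
    using that H(1) by simp
qed

end

section \<open>The rank formula\<close>

locale complemented_modular_polymatroid = modular_polymatroid r
  for r :: "'a::{finite,complete_lattice,modular_lattice,complementable_lattice} \<Rightarrow> real"
begin

lemma rank_le_rank_plus_mu:
  assumes "sup A (inf Z X) = X"
  shows "r X \<le> r Z + mu r A"
proof -
  obtain \<beta> where "atom_basis A \<beta>" "mu r A = (\<Sum>x\<in>\<beta>. r x)"
    by (rule mu_attained)
  then have "r A \<le> mu r A"
    using rank_Sup_le[of \<beta>] by (simp add: atom_basis_def)
  moreover have "r X \<le> r A + r (inf Z X)"
    using rank_sup_le[of A "inf Z X"] assms by simp
  moreover have "r (inf Z X) \<le> r Z"
    by (rule rank_mono) simp
  ultimately show ?thesis by linarith
qed

text \<open>Asking for \<open>r X = r F\<close> rather than \<open>F = cl r X\<close> gives a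
  hypothesis that passes to \<open>inf H X\<close> and \<open>H\<close> in the induction.\<close>

lemma ex_atom_basis_rank_eq:
  assumes "X \<le> F" "r X = r F" "inf A (cyc r F) = bot" "sup A (inf (cyc r F) X) = X"
  shows "\<exists>\<beta>. atom_basis A \<beta> \<and> r F = r (cyc r F) + (\<Sum>x\<in>\<beta>. r x)"
  using assms
proof (induction "height F" arbitrary: F X A rule: less_induct)
  case less
  let ?Z = "cyc r F"
  have "A \<le> X" using less.prems(4) by (metis sup.cobounded1)
  show ?case
  proof (cases "cyclic r F")
    case True
    \<comment> \<open>The descent ends: \<open>A\<close> lies below \<open>?Z\<close> and meets it
      in \<open>bot\<close>, so \<open>A = bot\<close> and the empty basis has sum
      \<open>0\<close>.\<close>
    then have "?Z = F"
      using cyc_greatest[of F F] cyc_le[of F] by simp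
    moreover from this have "A = bot"
      using less.prems(1,3) \<open>A \<le> X\<close> by (metis inf.absorb1 order.trans)
    ultimately show ?thesis
      by (auto simp: atom_basis_bot)
  next
    case False
    then obtain H where H: "covered_by H F" "r H < r F" "cyc r H = ?Z"
      and at: "\<And>a. a \<in> atoms_below F \<Longrightarrow> \<not> a \<le> H \<Longrightarrow> r a = r F - r H"
      by (rule noncyclic_hyperplane) blast
    have ZH: "?Z \<le> H"
      using cyc_le[of H] H(3) by simp
    have XH: "\<not> X \<le> H"
      using rank_mono[of X H] H(2) less.prems(2) by auto
    have "\<not> A \<le> H"
    proof
      assume "A \<le> H"
      then have "sup A (inf ?Z X) \<le> H"
        using ZH by (simp add: le_infI1)
      then show False using XH less.prems(4) by simp
    qed
    \<comment> \<open>This atom of \<open>A\<close> has rank exactly \<open>r F - r H\<close>,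
      paying for the step from \<open>H\<close> to \<open>F\<close>.\<close>
    then obtain a where a: "a \<in> atoms_below A" "\<not> a \<le> H"
      by (rule ex_atom_below_not_below)
    have aX: "a \<in> atoms_below X" and aF: "a \<in> atoms_below F"
      using a \<open>A \<le> X\<close> less.prems(1) by (auto simp: atoms_below_def)
    have ra: "r a = r F - r H"
      using at aF a by simp
    \<comment> \<open>The drop inside \<open>X\<close> is at most \<open>r a = r F - r H\<close>, so
      \<open>r (inf H X) \<ge> r H\<close>; monotonicity gives equality.\<close>
    have "r X - r (inf H X) \<le> r a"
      using covered_by_inf[OF H(1) less.prems(1) XH] aX a(2) by (intro rank_diff_le_atom) auto
    then have "r (inf H X) = r H"
      using ra less.prems(2) rank_mono[of "inf H X" H] by simp
    moreover have "inf (inf H A) ?Z = bot"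
      using less.prems(3) by (simp add: inf.assoc)
    moreover have "sup (inf H A) (inf ?Z (inf H X)) = inf H X"
    proof -
      \<comment> \<open>As \<open>inf ?Z X\<close> lies below \<open>H\<close>, modularity shows
        that meeting the splitting of \<open>X\<close> with \<open>H\<close> cuts only
        \<open>A\<close>.\<close>
      have "sup (inf ?Z X) (inf A H) = inf (sup (inf ?Z X) A) H"
        using ZH by (intro modular_law) (simp add: le_infI1)
      moreover have "inf ?Z (inf H X) = inf ?Z X"
        using ZH by (simp add: inf.assoc[symmetric] inf.absorb1)
      ultimately show ?thesis
        using less.prems(4) by (simp add: ac_simps)
    qed
    ultimately obtain \<beta> where \<beta>: "atom_basis (inf H A) \<beta>" "r H = r ?Z + (\<Sum>x\<in>\<beta>. r x)"
      using less.hyps[of H "inf H X" "inf H A"] H(3) height_less[OF covered_by_less[OF H(1)]]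
      by auto
    have "covered_by (inf H A) A"
      using \<open>A \<le> X\<close> less.prems(1) \<open>\<not> A \<le> H\<close> by (intro covered_by_inf[OF H(1)]) auto
    then have "atom_basis A (insert a \<beta>)" "a \<notin> \<beta>"
      using atom_basis_insert[OF _ \<beta>(1) a(1)] a(2) by auto
    moreover from this have "r F = r ?Z + (\<Sum>x\<in>insert a \<beta>. r x)"
      using \<beta>(2) ra by simp
    ultimately show ?thesis by blast
  qed
qed

lemma rank_eq_cyc_cl_plus_mu:
  assumes "Zc \<in> complements_wrt (cyc r (cl r X)) X"
  shows "r X = r (cyc r (cl r X)) + mu r (inf Zc X)"
proof (rule order.antisym)
  let ?Z = "cyc r (cl r X)"
  have Zc: "inf Zc ?Z = bot" "sup (inf Zc X) (inf ?Z X) = X"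
    using assms by (auto simp: complements_wrt_def complements_def)
  then show "r X \<le> r ?Z + mu r (inf Zc X)"
    by (intro rank_le_rank_plus_mu)
  have "inf (inf Zc X) ?Z = bot"
    using Zc(1) by (metis inf.assoc inf.commute inf_bot_left)
  then obtain \<beta> where "atom_basis (inf Zc X) \<beta>" "r (cl r X) = r ?Z + (\<Sum>x\<in>\<beta>. r x)"
    using ex_atom_basis_rank_eq[OF le_cl rank_cl[symmetric]] Zc(2) by blast
  then show "r ?Z + mu r (inf Zc X) \<le> r X"
    using mu_le[of "inf Zc X" \<beta> r] by (simp add: rank_cl)
qed

end

theorem theorem4p18:
  fixes r :: "'a::{finite,complete_lattice,modular_lattice,complementable_lattice} \<Rightarrow> real"
    and X :: 'a
  assumes "polymatroid r"
  shows "r X = Min {r Z + mu r (inf Zc X) | Z Zc. Z \<in> cyclic_flats r \<and> Zc \<in> complements_wrt Z X}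
    \<and> (\<forall>Z. Z = cyc r (cl r X) \<longrightarrow>
          (\<forall>Zc\<in>complements_wrt Z X. r X = r Z + mu r (inf X Zc)))"
proof -
  interpret complemented_modular_polymatroid r
    using assms by unfold_locales
  let ?S = "{r Z + mu r (inf Zc X) | Z Zc. Z \<in> cyclic_flats r \<and> Zc \<in> complements_wrt Z X}"
  have "Min ?S = r X"
  proof (rule Min_eqI)
    have "?S \<subseteq> (\<lambda>(Z, Zc). r Z + mu r (inf Zc X)) ` UNIV"
      by auto
    then show "finite ?S"
      by (rule finite_subset) simp
    show "r X \<le> y" if "y \<in> ?S" for y
      using that rank_le_rank_plus_mu by (auto simp: complements_wrt_def)
    \<comment> \<open>The value is attained at the cyclic flat \<open>cyc r (cl r X)\<close> with
      any admissible complement, and one exists.\<close>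
    show "r X \<in> ?S"
      using ex_complements_wrt[of "cyc r (cl r X)" X] cyc_cl_in_cyclic_flats
        rank_eq_cyc_cl_plus_mu by blast
  qed
  then show ?thesis
    using rank_eq_cyc_cl_plus_mu by (simp add: inf.commute)
qed

end
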